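(* Let $B$ be a skew brace and let $A_1, A_2$ be subbraces of $B$ satisfying the following conditions: (1) $A_1$ and $A_2$ are abelian skew braces; (2) $B = A_1 + A_2$ or $B = A_1A_2$; (3) $A_1$ is a left and right ideal of $B$. Then the commutator $[B,B]^B$ is an abelian skew brace.
   Context: A (left) skew brace $(B,+,\cdot)$ is a set with two group structures $(B,+)$ and $(B,\cdot)$ (neither assumed abelian) such that $a(b+c) = ab - a + ac$ for all $a,b,c\in B$. The two identity elements coincide. Put $a * b = -a + ab - b$. For $X,Y\subseteq B$, $X*Y$ denotes the subgroup of $(B,+)$ generated by $\{x*y : x\in X, y\in Y\}$; $X+Y=\{x+y : x\in X, y\in Y\}$ and $XY=\{xy : x\in X,y\in Y\}$ are the element-wise sum and product sets; $[X,Y]_+$ and $[X,Y]_\bullet$ denote the commutator subgroups in $(B,+)$ and $(B,\cdot)$ respectively. A subbrace of $B$ is a subset that is a subgroup of both $(B,+)$ and $(B,\cdot)$. A skew brace is trivial if $a*b=0$ for all $a,b$ (equivalently, $a+b=ab$ for all $a,b$), and abelian if it is trivial and its additive group is abelian. A subbrace $L$ is a left ideal if $B*L\subseteq L$, and a right ideal if $L*B\subseteq L$. A strong left ideal is a left ideal $I$ with $(I,+)$ normal in $(B,+)$. An ideal is a strong left ideal which is also a right ideal. The commutator $[B,B]^B$ is the ideal of $B$ generated by $[B,B]_+\cup[B,B]_\bullet\cup\{ab-(a+b) : a,b\in B\}$. *)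

theory Defs
  imports "HOL-Algebra.Algebra"
begin

text \<open>
  A skew brace is carried by the ring record type, whose two operations share one carrier.
  Nothing of the ring axioms is assumed: the additive group \<^term>\<open>add_monoid B\<close> need not be
  commutative, and \<^term>\<open>\<ominus>\<^bsub>B\<^esub> a\<close> is its inverse.  The two identities
  \<^term>\<open>\<zero>\<^bsub>B\<^esub>\<close> and \<^term>\<open>\<one>\<^bsub>B\<^esub>\<close> coincide,
  by the lemma \<open>one_eq_zero\<close> below.
\<close>

locale skew_brace = group B for B :: "('a, 'm) ring_scheme" (structure) +
  assumes add_group: "group (add_monoid B)"
    and brace_distrib:
      "\<lbrakk>a \<in> carrier B; b \<in> carrier B; c \<in> carrier B\<rbrakk>
        \<Longrightarrow> a \<otimes> (b \<oplus> c) = a \<otimes> b \<ominus> a \<oplus> a \<otimes> c"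

definition star :: "('a, 'm) ring_scheme \<Rightarrow> 'a \<Rightarrow> 'a \<Rightarrow> 'a" (infixl \<open>\<star>\<index>\<close> 70)
  where "a \<star>\<^bsub>B\<^esub> b = \<ominus>\<^bsub>B\<^esub> a \<oplus>\<^bsub>B\<^esub> a \<otimes>\<^bsub>B\<^esub> b \<ominus>\<^bsub>B\<^esub> b"

definition star_span :: "('a, 'm) ring_scheme \<Rightarrow> 'a set \<Rightarrow> 'a set \<Rightarrow> 'a set"
  where "star_span B S T = generate (add_monoid B) {x \<star>\<^bsub>B\<^esub> y | x y. x \<in> S \<and> y \<in> T}"

locale trivial_skew_brace = skew_brace +
  assumes star_zero: "\<lbrakk>a \<in> carrier B; b \<in> carrier B\<rbrakk> \<Longrightarrow> a \<star> b = \<zero>"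

locale abelian_skew_brace = trivial_skew_brace +
  assumes add_comm: "\<lbrakk>a \<in> carrier B; b \<in> carrier B\<rbrakk> \<Longrightarrow> a \<oplus> b = b \<oplus> a"

definition subbrace :: "('a, 'm) ring_scheme \<Rightarrow> 'a set \<Rightarrow> bool"
  where "subbrace B L \<longleftrightarrow> subgroup L (add_monoid B) \<and> subgroup L B"

definition left_ideal :: "('a, 'm) ring_scheme \<Rightarrow> 'a set \<Rightarrow> bool"
  where "left_ideal B L \<longleftrightarrow> subbrace B L \<and> star_span B (carrier B) L \<subseteq> L"

definition right_ideal :: "('a, 'm) ring_scheme \<Rightarrow> 'a set \<Rightarrow> bool"
  where "right_ideal B L \<longleftrightarrow> subbrace B L \<and> star_span B L (carrier B) \<subseteq> L"

definition strong_left_ideal :: "('a, 'm) ring_scheme \<Rightarrow> 'a set \<Rightarrow> bool"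
  where "strong_left_ideal B I \<longleftrightarrow> left_ideal B I \<and> I \<lhd> add_monoid B"

definition brace_ideal :: "('a, 'm) ring_scheme \<Rightarrow> 'a set \<Rightarrow> bool"
  where "brace_ideal B I \<longleftrightarrow> strong_left_ideal B I \<and> right_ideal B I"

definition generated_ideal :: "('a, 'm) ring_scheme \<Rightarrow> 'a set \<Rightarrow> 'a set"
  where "generated_ideal B S = \<Inter> {I. brace_ideal B I \<and> S \<subseteq> I}"

definition brace_commutator :: "('a, 'm) ring_scheme \<Rightarrow> 'a set"
  where "brace_commutator B =
    generated_ideal B
      (derived (add_monoid B) (carrier B) \<union> derived B (carrier B) \<union>
       {a \<otimes>\<^bsub>B\<^esub> b \<ominus>\<^bsub>B\<^esub> (a \<oplus>\<^bsub>B\<^esub> b) | a b. a \<in> carrier B \<and> b \<in> carrier B})"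

context skew_brace
begin

interpretation add: group "add_monoid B"
  rewrites "carrier (add_monoid B) = carrier B"
    and "monoid.mult (add_monoid B) = add B"
    and "one (add_monoid B) = \<zero>"
    and "m_inv (add_monoid B) = a_inv B"
  using add_group by (auto simp: a_inv_def)

lemma one_eq_zero: "\<one> = \<zero>"
proof -
  have "\<one> \<otimes> (\<zero> \<oplus> \<zero>) = \<one> \<otimes> \<zero> \<ominus> \<one> \<oplus> \<one> \<otimes> \<zero>"
    by (rule brace_distrib) auto
  hence "\<ominus> \<one> = \<zero>"
    by (simp add: a_minus_def)
  thus ?thesis
    using add.inv_eq_1_iff[OF one_closed] by blast
qed

lemma star_closed: "\<lbrakk>a \<in> carrier B; b \<in> carrier B\<rbrakk> \<Longrightarrow> a \<star> b \<in> carrier B"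
  by (simp add: star_def a_minus_def)

lemma subbrace_is_skew_brace:
  assumes "subbrace B L"
  shows "skew_brace (B\<lparr>carrier := L\<rparr>)"
proof -
  have L: "subgroup L (add_monoid B)" "subgroup L B"
    using assms by (auto simp: subbrace_def)
  have sub: "L \<subseteq> carrier B"
    using L(2) by (rule subgroup.subset)
  have inv: "\<ominus>\<^bsub>B\<lparr>carrier := L\<rparr>\<^esub> x = \<ominus> x" if "x \<in> L" for x
    using add.m_inv_consistent[OF L(1) that] by (simp add: a_inv_def)
  show ?thesis
  proof (intro skew_brace.intro skew_brace_axioms.intro)
    show "group (B\<lparr>carrier := L\<rparr>)"
      by (rule subgroup_imp_group[OF L(2)])
    show "group (add_monoid (B\<lparr>carrier := L\<rparr>))"
      using add.subgroup_imp_group[OF L(1)] by simp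
  next
    fix a b c
    assume "a \<in> carrier (B\<lparr>carrier := L\<rparr>)" "b \<in> carrier (B\<lparr>carrier := L\<rparr>)"
      "c \<in> carrier (B\<lparr>carrier := L\<rparr>)"
    thus "a \<otimes>\<^bsub>B\<lparr>carrier := L\<rparr>\<^esub> (b \<oplus>\<^bsub>B\<lparr>carrier := L\<rparr>\<^esub> c) =
      a \<otimes>\<^bsub>B\<lparr>carrier := L\<rparr>\<^esub> b \<ominus>\<^bsub>B\<lparr>carrier := L\<rparr>\<^esub> a \<oplus>\<^bsub>B\<lparr>carrier := L\<rparr>\<^esub> a \<otimes>\<^bsub>B\<lparr>carrier := L\<rparr>\<^esub> c"
      using brace_distrib[of a b c] sub by (auto simp: a_minus_def inv)
  qed
qed

lemma brace_ideal_carrier: "brace_ideal B (carrier B)"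
proof -
  have *: "star_span B (carrier B) (carrier B) \<subseteq> carrier B"
    unfolding star_span_def
    using add.generate_incl[of "{x \<star> y | x y. x \<in> carrier B \<and> y \<in> carrier B}"] star_closed
    by fastforce
  have "carrier B \<lhd> add_monoid B"
    using add.normal_inv_iff add.subgroup_self by auto
  with * show ?thesis
    using add.subgroup_self subgroup_self
    by (simp add: brace_ideal_def strong_left_ideal_def left_ideal_def right_ideal_def subbrace_def)
qed

lemma brace_ideal_generated_ideal:
  assumes "S \<subseteq> carrier B"
  shows "brace_ideal B (generated_ideal B S)"
proof -
  let ?J = "{I. brace_ideal B I \<and> S \<subseteq> I}"
  note defs = brace_ideal_def strong_left_ideal_def left_ideal_def right_ideal_def subbrace_def
  have ne: "?J \<noteq> {}"
    using assms brace_ideal_carrier by blast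
  have 1: "subgroup (\<Inter> ?J) (add_monoid B)"
    using ne by (intro add.subgroups_Inter) (auto simp: defs)
  have 2: "subgroup (\<Inter> ?J) B"
    using ne by (intro subgroups_Inter) (auto simp: defs)
  have 3: "star_span B (carrier B) (\<Inter> ?J) \<subseteq> I \<and> star_span B (\<Inter> ?J) (carrier B) \<subseteq> I"
    if "I \<in> ?J" for I
  proof -
    have le: "\<Inter> ?J \<subseteq> I"
      using that by (rule Inter_lower)
    have "star_span B (carrier B) (\<Inter> ?J) \<subseteq> star_span B (carrier B) I"
      unfolding star_span_def by (rule add.mono_generate) (use le in fast)
    moreover have "star_span B (\<Inter> ?J) (carrier B) \<subseteq> star_span B I (carrier B)"
      unfolding star_span_def by (rule add.mono_generate) (use le in fast)
    moreover have "star_span B (carrier B) I \<subseteq> I" "star_span B I (carrier B) \<subseteq> I"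
      using that by (simp_all add: defs)
    ultimately show ?thesis
      by (meson subset_trans)
  qed
  have 4: "\<Inter> ?J \<lhd> add_monoid B"
  proof -
    have "x \<oplus> h \<oplus> \<ominus> x \<in> \<Inter> ?J" if "x \<in> carrier B" "h \<in> \<Inter> ?J" for x h
    proof (rule InterI)
      fix I assume I: "I \<in> ?J"
      hence "I \<lhd> add_monoid B" "h \<in> I"
        using that(2) by (auto simp only: defs mem_Collect_eq)
      thus "x \<oplus> h \<oplus> \<ominus> x \<in> I"
        using that(1) add.normal_inv_iff by blast
    qed
    with 1 show ?thesis
      unfolding add.normal_inv_iff by blast
  qed
  have 5: "star_span B (carrier B) (\<Inter> ?J) \<subseteq> \<Inter> ?J" "star_span B (\<Inter> ?J) (carrier B) \<subseteq> \<Inter> ?J"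
    using 3 by (intro Inter_greatest; meson)+
  have "brace_ideal B (\<Inter> ?J)"
    unfolding defs[of B "\<Inter> ?J"] by (intro conjI 1 2 4 5)
  thus ?thesis
    by (simp only: generated_ideal_def)
qed

end

end

theory Submission
  imports Defs
begin

text \<open>
  Write \<open>\<lambda>\<^sub>x y = -x + xy\<close>, \<open>H = A\<^sub>1\<close>, \<open>K = A\<^sub>2\<close>.  Since \<open>H\<close> is a left ideal, both factorisation
  hypotheses are equivalent, and both groups of \<open>B\<close> are products of \<open>H\<close> and \<open>K\<close>.  Ito's trick
  shows that conjugations by \<open>h \<in> H\<close> and by \<open>k \<in> K\<close> commute on the set \<open>X\<close> of additive commutators
  \<open>[h, k]\<close>; the same computation shows that \<open>\<lambda>\<^sub>h\<close> commutes with conjugation by \<open>k\<close>, and \<open>\<lambda>\<^sub>k\<close> with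
  conjugation by \<open>h\<close>.  As \<open>\<lambda>\<^sub>h k = h * k + k\<close>, this makes \<open>h * k\<close> and \<open>k * h\<close> (elements of \<open>H\<close>)
  commute with \<open>X\<close>.  Hence the additive subgroup \<open>I\<close> generated by \<open>X\<close> and all \<open>h * k\<close>, \<open>k * h\<close> is
  abelian; it is an ideal containing the commutator.

  To see that \<open>I\<close> is trivial as a brace, let \<open>S\<close> be the additive span of the \<open>h * k\<close>.  It is normal
  and invariant under \<open>\<lambda>\<close>.  The elements \<open>m\<close> with \<open>m * B \<subseteq> S\<close> and \<open>\<lambda>\<^sub>m = id\<close> on \<open>I\<close> form a normal
  multiplicative subgroup \<open>M\<close> containing \<open>H\<close>, such that \<open>xM = yM\<close> implies \<open>x - y \<in> M\<close>.  Since \<open>h + k\<close>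
  and \<open>k + h\<close> both lie in \<open>kM\<close>, all of \<open>X\<close>, and therefore \<open>I\<close>, lies in \<open>M\<close>.
\<close>

section \<open>Groups factorised by two abelian subgroups\<close>

definition group_commutator :: "('a, 'm) monoid_scheme \<Rightarrow> 'a \<Rightarrow> 'a \<Rightarrow> 'a"
  where "group_commutator G x y = x \<otimes>\<^bsub>G\<^esub> y \<otimes>\<^bsub>G\<^esub> inv\<^bsub>G\<^esub> x \<otimes>\<^bsub>G\<^esub> inv\<^bsub>G\<^esub> y"

context group
begin

lemma inv_cancel_left [simp]:
  assumes "x \<in> carrier G" "y \<in> carrier G"
  shows "inv x \<otimes> (x \<otimes> y) = y" "x \<otimes> (inv x \<otimes> y) = y"
  using assms by (simp_all flip: m_assoc)

text \<open>Inversion swaps the factors: \<open>inv x = h \<otimes> k\<close> gives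
  \<open>x = inv k \<otimes> inv h\<close>.\<close>

lemma set_mult_subgroups_commute:
  assumes "subgroup H G" "subgroup K G" "carrier G = H <#> K"
  shows "carrier G = K <#> H"
proof -
  interpret H: subgroup H G by fact
  interpret K: subgroup K G by fact
  have "\<exists>k\<in>K. \<exists>h\<in>H. x = k \<otimes> h" if x: "x \<in> carrier G" for x
  proof -
    have "inv x \<in> H <#> K"
      using inv_closed[OF x] unfolding assms(3) .
    then obtain h k where hk: "h \<in> H" "k \<in> K" "inv x = h \<otimes> k"
      by (auto simp: set_mult_def)
    hence "x = inv k \<otimes> inv h"
      using x by (metis H.mem_carrier K.mem_carrier inv_inv inv_mult_group)
    with hk show ?thesis by blast
  qed
  thus ?thesis
    by (auto simp: set_mult_def)
qed

lemma group_commutator_closed [simp]: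
  "\<lbrakk>x \<in> carrier G; y \<in> carrier G\<rbrakk> \<Longrightarrow> group_commutator G x y \<in> carrier G"
  by (simp add: group_commutator_def)

lemma commute_if_conj_fixed:
  assumes "x \<in> carrier G" "y \<in> carrier G" "y = x \<otimes> y \<otimes> inv x"
  shows "x \<otimes> y = y \<otimes> x"
proof -
  have "y \<otimes> x = x \<otimes> y \<otimes> inv x \<otimes> x"
    using arg_cong[OF assms(3), of "\<lambda>z. z \<otimes> x"] .
  with assms(1,2) show ?thesis
    by (simp add: m_assoc)
qed

lemma generate_hom_closed:
  assumes "f \<in> hom G G" "S \<subseteq> carrier G" "f ` S \<subseteq> generate G S" "x \<in> generate G S"
  shows "f x \<in> generate G S"
proof -
  interpret group_hom G G f
    using assms(1) by unfold_locales
  have "f x \<in> generate G (f ` S)"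
    using assms by (simp add: generate_img)
  also have "\<dots> \<subseteq> generate G S"
    using assms(2,3) by (intro generate_subgroup_incl generate_is_subgroup)
  finally show ?thesis .
qed

text \<open>Two inductions, one per argument: first one side is kept a generator, then both sides
  range over the span.\<close>

lemma generate_commute:
  assumes "S \<subseteq> carrier G" "\<And>x y. \<lbrakk>x \<in> S; y \<in> S\<rbrakk> \<Longrightarrow> x \<otimes> y = y \<otimes> x"
    and "x \<in> generate G S" "y \<in> generate G S"
  shows "x \<otimes> y = y \<otimes> x"
proof -
  have inv_comm: "inv u \<otimes> v = v \<otimes> inv u"
    if "u \<in> carrier G" "v \<in> carrier G" "u \<otimes> v = v \<otimes> u" for u v
    using that by (metis inv_closed inv_solve_left inv_solve_right m_assoc m_closed)
  have mult_comm: "(u \<otimes> v) \<otimes> w = w \<otimes> (u \<otimes> v)"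
    if "u \<in> carrier G" "v \<in> carrier G" "w \<in> carrier G" "u \<otimes> w = w \<otimes> u" "v \<otimes> w = w \<otimes> v" for u v w
    using that by (metis m_assoc)
  note incl = generate_in_carrier[OF assms(1)]
  have S: "u \<otimes> y = y \<otimes> u" if "u \<in> generate G S" "y \<in> S" for u y
    using that(1)
  proof induction
    case one thus ?case using that assms(1) by auto
  next
    case (incl h) thus ?case using that assms(2) by blast
  next
    case (inv h) thus ?case using that assms inv_comm by blast
  next
    case (eng h1 h2) thus ?case using that assms(1) mult_comm incl by blast
  qed
  show ?thesis
    using assms(4)
  proof induction
    case one thus ?case using incl[OF assms(3)] by simp
  next
    case (incl h) thus ?case using S assms(3) by blast
  next
    case (inv h) 
    thus ?case using S[OF assms(3)] inv_comm[of h x] incl[OF assms(3)] assms(1) by (metis subsetD)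
  next
    case (eng h1 h2) thus ?case using incl assms(3) mult_comm[of h1 h2 x] by metis
  qed
qed

end

locale abelian_factorization = group G for G (structure) +
  fixes H K
  assumes subgroup_H: "subgroup H G" and subgroup_K: "subgroup K G"
    and H_comm: "\<lbrakk>x \<in> H; y \<in> H\<rbrakk> \<Longrightarrow> x \<otimes> y = y \<otimes> x"
    and K_comm: "\<lbrakk>x \<in> K; y \<in> K\<rbrakk> \<Longrightarrow> x \<otimes> y = y \<otimes> x"
    and factorization: "carrier G = H <#> K"
begin

sublocale H: subgroup H G by (rule subgroup_H)
sublocale K: subgroup K G by (rule subgroup_K)

definition "commutators = {group_commutator G h k | h k. h \<in> H \<and> k \<in> K}"

lemma commutators_carrier: "commutators \<subseteq> carrier G"
  by (auto simp: commutators_def)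

lemma factor_HK:
  assumes "x \<in> carrier G" obtains h k where "h \<in> H" "k \<in> K" "x = h \<otimes> k"
  using assms factorization by (auto simp: set_mult_def)

lemma factor_KH:
  assumes "x \<in> carrier G" obtains k h where "k \<in> K" "h \<in> H" "x = k \<otimes> h"
  using assms set_mult_subgroups_commute[OF subgroup_H subgroup_K factorization]
  by (auto simp: set_mult_def)

text \<open>Once \<open>k1 \<otimes> h\<close> is rewritten as \<open>h' \<otimes> k'\<close>, the
  factor \<open>k'\<close> commutes with \<open>k\<close> and cancels. Conjugation by
  \<open>k1\<close> therefore changes only the first entry, and \<open>h'\<close> does not depend on
  \<open>k\<close>.\<close>

lemma conj_commutator_K:
  assumes "h \<in> H" "k \<in> K" "k1 \<in> K" "h' \<in> H" "k' \<in> K" "k1 \<otimes> h = h' \<otimes> k'"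
  shows "k1 \<otimes> group_commutator G h k \<otimes> inv k1 = group_commutator G h' k"
proof -
  have k: "k1 \<otimes> inv k = inv k \<otimes> k1" "k' \<otimes> k = k \<otimes> k'"
    using assms K_comm by auto
  have "k1 \<otimes> group_commutator G h k \<otimes> inv k1 = (k1 \<otimes> h) \<otimes> k \<otimes> inv (k1 \<otimes> h) \<otimes> (k1 \<otimes> inv k) \<otimes> inv k1"
    using assms(1-5) by (simp add: group_commutator_def m_assoc inv_mult_group)
  also have "\<dots> = h' \<otimes> (k' \<otimes> k) \<otimes> inv k' \<otimes> inv h' \<otimes> inv k"
    unfolding k(1) assms(6) using assms by (simp add: m_assoc inv_mult_group)
  also have "\<dots> = group_commutator G h' k"
    unfolding k(2) using assms by (simp add: group_commutator_def m_assoc)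
  finally show ?thesis .
qed

text \<open>The mirror image: conjugation by \<open>h1\<close> changes only the second entry, and
  \<open>k'\<close> does not depend on \<open>h\<close>.\<close>

lemma conj_commutator_H:
  assumes "h \<in> H" "k \<in> K" "h1 \<in> H" "h' \<in> H" "k' \<in> K" "h1 \<otimes> k = k' \<otimes> h'"
  shows "h1 \<otimes> group_commutator G h k \<otimes> inv h1 = group_commutator G h k'"
proof -
  have k: "h1 \<otimes> h = h \<otimes> h1" "h' \<otimes> inv h = inv h \<otimes> h'"
    using assms H_comm by auto
  have "h1 \<otimes> group_commutator G h k \<otimes> inv h1 = (h1 \<otimes> h) \<otimes> k \<otimes> inv h \<otimes> inv (h1 \<otimes> k)"
    using assms(1-5) by (simp add: group_commutator_def m_assoc inv_mult_group)
  also have "\<dots> = h \<otimes> (h1 \<otimes> k) \<otimes> inv h \<otimes> inv (h1 \<otimes> k)"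
    unfolding k using assms(1-5) by (simp add: m_assoc inv_mult_group)
  also have "\<dots> = h \<otimes> k' \<otimes> (h' \<otimes> inv h) \<otimes> inv h' \<otimes> inv k'"
    unfolding assms(6) using assms by (simp add: m_assoc inv_mult_group)
  also have "\<dots> = group_commutator G h k'"
    unfolding k(2) using assms by (simp add: group_commutator_def m_assoc)
  finally show ?thesis .
qed

lemma commutators_conj_K:
  assumes "k1 \<in> K" "x \<in> commutators"
  shows "k1 \<otimes> x \<otimes> inv k1 \<in> commutators"
proof -
  obtain h k where x: "h \<in> H" "k \<in> K" "x = group_commutator G h k"
    using assms(2) by (auto simp: commutators_def)
  have "k1 \<otimes> h \<in> carrier G" using x assms by simp
  then obtain h' k' where "h' \<in> H" "k' \<in> K" "k1 \<otimes> h = h' \<otimes> k'" by (rule factor_HK)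
  with x assms conj_commutator_K[of h k k1 h' k'] show ?thesis
    by (auto simp: commutators_def)
qed

lemma commutators_conj_H:
  assumes "h1 \<in> H" "x \<in> commutators"
  shows "h1 \<otimes> x \<otimes> inv h1 \<in> commutators"
proof -
  obtain h k where x: "h \<in> H" "k \<in> K" "x = group_commutator G h k"
    using assms(2) by (auto simp: commutators_def)
  have "h1 \<otimes> k \<in> carrier G" using x assms by simp
  then obtain h' k' where "k' \<in> K" "h' \<in> H" "h1 \<otimes> k = k' \<otimes> h'" by (rule factor_KH)
  with x assms conj_commutator_H[of h k h1 h' k'] show ?thesis
    by (auto simp: commutators_def)
qed

text \<open>The two conjugations substitute in different entries of the commutator, and each
  substitution ignores the other entry.\<close>

lemma conj_conj_commutators:
  assumes "h1 \<in> H" "k1 \<in> K" "x \<in> commutators"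
  shows "h1 \<otimes> (k1 \<otimes> x \<otimes> inv k1) \<otimes> inv h1 = k1 \<otimes> (h1 \<otimes> x \<otimes> inv h1) \<otimes> inv k1"
proof -
  obtain h k where x: "h \<in> H" "k \<in> K" "x = group_commutator G h k"
    using assms(3) by (auto simp: commutators_def)
  have "k1 \<otimes> h \<in> carrier G" using x assms by simp
  then obtain h' k' where 1: "h' \<in> H" "k' \<in> K" "k1 \<otimes> h = h' \<otimes> k'" by (rule factor_HK)
  have "h1 \<otimes> k \<in> carrier G" using x assms by simp
  then obtain h'' k'' where 2: "k'' \<in> K" "h'' \<in> H" "h1 \<otimes> k = k'' \<otimes> h''" by (rule factor_KH)
  show ?thesis
    using x assms 1 2 conj_commutator_K[of h _ k1 h' k'] conj_commutator_H[of _ k h1 h'' k'']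
    by simp
qed

text \<open>Supplies preimages, so that a given commutator can be written as an iterated conjugate
  before the order of the conjugations is exchanged.\<close>

lemma conj_surj_commutators:
  assumes "g \<in> H \<union> K" "x \<in> commutators"
  obtains y where "y \<in> commutators" "x = g \<otimes> y \<otimes> inv g"
proof
  have "inv g \<otimes> x \<otimes> inv (inv g) \<in> commutators"
    using assms commutators_conj_H commutators_conj_K by blast
  thus "inv g \<otimes> x \<otimes> g \<in> commutators"
    using assms by auto
  show "x = g \<otimes> (inv g \<otimes> x \<otimes> g) \<otimes> inv g"
    using assms commutators_carrier by (auto simp: m_assoc)
qed

text \<open>With one and the same \<open>z\<close>, \<open>y\<close> is the conjugate of
  \<open>z\<close> by \<open>h \<otimes> k\<close> and also by \<open>k \<otimes> h\<close>. Since
  \<open>x\<close> carries \<open>k \<otimes> h\<close> to \<open>h \<otimes> k\<close>, conjugation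
  by \<open>x\<close> fixes \<open>y\<close>.\<close>

lemma commutators_commute:
  assumes "x \<in> commutators" "y \<in> commutators"
  shows "x \<otimes> y = y \<otimes> x"
proof -
  obtain h k where x: "h \<in> H" "k \<in> K" "x = group_commutator G h k"
    using assms(1) by (auto simp: commutators_def)
  obtain y1 where y1: "y1 \<in> commutators" "y = h \<otimes> y1 \<otimes> inv h"
    by (rule conj_surj_commutators[of h y]) (use x assms in auto)
  obtain z where z: "z \<in> commutators" "y1 = k \<otimes> z \<otimes> inv k"
    by (rule conj_surj_commutators[of k y1]) (use x y1 in auto)
  have [simp]: "z \<in> carrier G" using z commutators_carrier by auto
  have y: "y = h \<otimes> (k \<otimes> z \<otimes> inv k) \<otimes> inv h" 
    using y1 z by simp
  have y': "y = k \<otimes> (h \<otimes> z \<otimes> inv h) \<otimes> inv k"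
    using y conj_conj_commutators[OF x(1,2) z(1)] by simp
  have "x \<otimes> y = h \<otimes> (k \<otimes> z \<otimes> inv k) \<otimes> inv h \<otimes> x"
    unfolding x(3) y' group_commutator_def using x by (simp add: m_assoc)
  thus ?thesis
    unfolding y[symmetric] .
qed

lemma generate_commutators_conj:
  assumes "g \<in> carrier G" "x \<in> generate G commutators"
  shows "g \<otimes> x \<otimes> inv g \<in> generate G commutators"
proof -
  have "g \<otimes> y \<otimes> inv g \<in> commutators" if gc: "g \<in> carrier G" and y: "y \<in> commutators" for g y
  proof -
    obtain h k where g: "h \<in> H" "k \<in> K" "g = h \<otimes> k" using gc by (rule factor_HK)
    have "h \<otimes> (k \<otimes> y \<otimes> inv k) \<otimes> inv h \<in> commutators"
      using y g commutators_conj_H commutators_conj_K by simp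
    moreover have "g \<otimes> y \<otimes> inv g = h \<otimes> (k \<otimes> y \<otimes> inv k) \<otimes> inv h"
      using g y commutators_carrier by (auto simp: m_assoc inv_mult_group)
    ultimately show ?thesis by simp
  qed
  hence "generate G commutators \<lhd> G"
    by (intro normal_generateI commutators_carrier)
  thus ?thesis
    using assms normal_inv_iff by blast
qed

text \<open>Writing \<open>[x, y]\<close> for \<open>group_commutator G x y\<close>, the point is
  that \<open>[h k, h' k']\<close> is the conjugate of \<open>inv [h', k]\<close> by
  \<open>h\<close> times the conjugate of \<open>[h, k']\<close> by \<open>h'\<close>. The span is
  closed under conjugation.\<close>

lemma derived_subset_generate_commutators: "derived G (carrier G) \<subseteq> generate G commutators"
proof -
  let ?N = "generate G commutators"
  have N: "subgroup ?N G"
    by (rule generate_is_subgroup[OF commutators_carrier])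
  interpret N: subgroup ?N G by (rule N)
  have comm: "group_commutator G h k \<in> ?N" if "h \<in> H" "k \<in> K" for h k
    using that by (intro generate.incl) (auto simp: commutators_def)
  have "x \<otimes> y \<otimes> inv x \<otimes> inv y \<in> ?N" if xy: "x \<in> carrier G" "y \<in> carrier G" for x y
  proof -
    obtain h k where x: "h \<in> H" "k \<in> K" "x = h \<otimes> k" using xy(1) by (rule factor_HK)
    obtain h' k' where y: "h' \<in> H" "k' \<in> K" "y = h' \<otimes> k'" using xy(2) by (rule factor_HK)
    note xc = H.mem_carrier[OF x(1)] K.mem_carrier[OF x(2)] H.mem_carrier[OF y(1)] K.mem_carrier[OF y(2)]
    have c: "k' \<otimes> inv k = inv k \<otimes> k'" "h' \<otimes> h = h \<otimes> h'"
      using x y H_comm K_comm by auto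
    have c_inv: "inv h' \<otimes> inv h = inv h \<otimes> inv h'"
      using c(2) xc by (metis inv_mult_group)
    define p where "p = group_commutator G h' k"
    define q where "q = group_commutator G h k'"
    have pq: "p \<in> ?N" "q \<in> ?N" using x y comm by (auto simp: p_def q_def)
    note pc = N.mem_carrier[OF pq(1)] N.mem_carrier[OF pq(2)]
    have "h \<otimes> inv p \<otimes> inv h \<otimes> (h' \<otimes> q \<otimes> inv h') \<in> ?N"
      using pq xc by (intro N.m_closed generate_commutators_conj) auto
    moreover have "x \<otimes> y \<otimes> inv x \<otimes> inv y = h \<otimes> inv p \<otimes> inv h \<otimes> (h' \<otimes> q \<otimes> inv h')"
    proof -
      have "h \<otimes> inv p \<otimes> inv h \<otimes> (h' \<otimes> q \<otimes> inv h') = 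
          h \<otimes> k \<otimes> h' \<otimes> inv k \<otimes> (inv h' \<otimes> inv h) \<otimes> (h' \<otimes> h) \<otimes> k' \<otimes> inv h \<otimes> inv k' \<otimes> inv h'"
        using xc by (simp add: p_def q_def group_commutator_def m_assoc inv_mult_group)
      also have "\<dots> = h \<otimes> k \<otimes> h' \<otimes> (inv k \<otimes> k') \<otimes> inv h \<otimes> inv k' \<otimes> inv h'"
        unfolding c_inv using xc by (simp add: m_assoc inv_mult_group)
      also have "\<dots> = x \<otimes> y \<otimes> inv x \<otimes> inv y"
        unfolding c(1)[symmetric] using xc by (simp add: x(3) y(3) m_assoc inv_mult_group)
      finally show ?thesis by simp
    qed
    ultimately show ?thesis by simp
  qed
  thus ?thesis
    unfolding derived_def by (intro generate_subgroup_incl[OF _ N]) auto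
qed

end

section \<open>The lambda action of a skew brace\<close>

sublocale skew_brace \<subseteq> add: group "add_monoid B"
  rewrites "carrier (add_monoid B) = carrier B"
    and "monoid.mult (add_monoid B) = add B"
    and "one (add_monoid B) = \<zero>"
    and "m_inv (add_monoid B) = a_inv B"
  using add_group by (auto simp: a_inv_def)

context skew_brace
begin

text \<open>The standard action of the multiplicative group on the additive one: by
  \<open>lam_add\<close> and \<open>lam_mult\<close>, \<open>x\<close> acts through additive
  automorphisms.\<close>

definition lam :: "'a \<Rightarrow> 'a \<Rightarrow> 'a"
  where "lam x y = \<ominus> x \<oplus> x \<otimes> y"

lemma lam_closed [simp]: "\<lbrakk>x \<in> carrier B; y \<in> carrier B\<rbrakk> \<Longrightarrow> lam x y \<in> carrier B"
  by (simp add: lam_def)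

lemma mult_eq_add_lam:
  "\<lbrakk>x \<in> carrier B; y \<in> carrier B\<rbrakk> \<Longrightarrow> x \<otimes> y = x \<oplus> lam x y"
  by (simp add: lam_def)

lemma star_eq: "\<lbrakk>x \<in> carrier B; y \<in> carrier B\<rbrakk> \<Longrightarrow> x \<star> y = lam x y \<oplus> \<ominus> y"
  by (simp add: star_def lam_def a_minus_def)

lemma lam_eq_star_add: "\<lbrakk>x \<in> carrier B; y \<in> carrier B\<rbrakk> \<Longrightarrow> lam x y = x \<star> y \<oplus> y"
  by (simp add: star_eq add.m_assoc)

lemma lam_add:
  "\<lbrakk>x \<in> carrier B; y \<in> carrier B; z \<in> carrier B\<rbrakk> \<Longrightarrow> lam x (y \<oplus> z) = lam x y \<oplus> lam x z"
  by (simp add: lam_def brace_distrib a_minus_def add.m_assoc)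

lemma lam_zero [simp]: "x \<in> carrier B \<Longrightarrow> lam x \<zero> = \<zero>"
  using lam_add[of x \<zero> \<zero>] by simp

lemma lam_neg: "\<lbrakk>x \<in> carrier B; y \<in> carrier B\<rbrakk> \<Longrightarrow> lam x (\<ominus> y) = \<ominus> lam x y"
  using lam_add[of x "\<ominus> y" y] by (simp add: add.inv_equality)

text \<open>Expand \<open>lam y z\<close> and use additivity of \<open>lam x\<close>; the inner
  terms \<open>x\<close> and \<open>\<ominus> x\<close> then cancel.\<close>

lemma lam_mult:
  assumes "x \<in> carrier B" "y \<in> carrier B" "z \<in> carrier B"
  shows "lam (x \<otimes> y) z = lam x (lam y z)"
proof -
  have "lam x (lam y z) = \<ominus> lam x y \<oplus> lam x (y \<otimes> z)"
    using assms by (subst (2) lam_def) (simp add: lam_add lam_neg)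
  thus ?thesis
    using assms by (simp add: lam_def add.inv_mult_group add.m_assoc m_assoc)
qed

lemma lam_one [simp]: "x \<in> carrier B \<Longrightarrow> lam \<one> x = x"
  by (simp add: lam_def) (simp add: one_eq_zero)

lemma lam_inv_cancel [simp]:
  "\<lbrakk>x \<in> carrier B; y \<in> carrier B\<rbrakk> \<Longrightarrow> lam x (lam (inv x) y) = y"
  "\<lbrakk>x \<in> carrier B; y \<in> carrier B\<rbrakk> \<Longrightarrow> lam (inv x) (lam x y) = y"
  by (simp_all flip: lam_mult)

lemma add_eq_mult_lam:
  "\<lbrakk>x \<in> carrier B; y \<in> carrier B\<rbrakk> \<Longrightarrow> x \<oplus> y = x \<otimes> lam (inv x) y"
  by (simp add: mult_eq_add_lam)

lemma neg_eq_lam_inv: "x \<in> carrier B \<Longrightarrow> \<ominus> x = lam x (inv x)"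
  by (simp add: lam_def) (simp add: one_eq_zero)

lemma star_restrict:
  assumes "subgroup L (add_monoid B)" "x \<in> L" "y \<in> L"
  shows "x \<star>\<^bsub>B\<lparr>carrier := L\<rparr>\<^esub> y = x \<star> y"
proof -
  have "\<ominus>\<^bsub>B\<lparr>carrier := L\<rparr>\<^esub> z = \<ominus> z" if "z \<in> L" for z
    using add.m_inv_consistent[OF assms(1) that] by (simp add: a_inv_def)
  with assms(2,3) show ?thesis
    by (simp add: star_def a_minus_def)
qed

text \<open>Holds because \<open>lam (inv x)\<close> sends \<open>\<ominus> x\<close> to
  \<open>inv x\<close>. It turns additive quotients into multiplicative ones for sets invariant
  under \<open>lam\<close>.\<close>

lemma inv_mult_eq_lam:
  assumes "x \<in> carrier B" "y \<in> carrier B"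
  shows "inv x \<otimes> y = lam (inv x) (\<ominus> x \<oplus> y)"
  using assms by (simp add: lam_add neg_eq_lam_inv flip: mult_eq_add_lam)

lemma lam_hom: "x \<in> carrier B \<Longrightarrow> lam x \<in> hom (add_monoid B) (add_monoid B)"
  by (auto simp: hom_def lam_add)

lemma add_conj_hom:
  "x \<in> carrier B \<Longrightarrow> (\<lambda>y. x \<oplus> y \<oplus> \<ominus> x) \<in> hom (add_monoid B) (add_monoid B)"
  by (auto simp: hom_def add.m_assoc)

lemma star_mult:
  "\<lbrakk>x \<in> carrier B; y \<in> carrier B; z \<in> carrier B\<rbrakk> \<Longrightarrow> (x \<otimes> y) \<star> z = x \<star> lam y z \<oplus> y \<star> z"
  by (simp add: star_eq lam_mult add.m_assoc)

lemma star_add_right: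
  "\<lbrakk>x \<in> carrier B; y \<in> carrier B; z \<in> carrier B\<rbrakk>
    \<Longrightarrow> x \<star> (y \<oplus> z) = x \<star> y \<oplus> (y \<oplus> x \<star> z \<oplus> \<ominus> y)"
  by (simp add: star_eq lam_add add.m_assoc add.inv_mult_group)

lemma lam_star:
  assumes "x \<in> carrier B" "y \<in> carrier B" "z \<in> carrier B"
  shows "lam x (y \<star> z) = (x \<otimes> y \<otimes> inv x) \<star> lam x z"
  using assms by (simp add: star_eq lam_add lam_neg lam_mult m_assoc)

lemma group_commutator_add:
  "group_commutator (add_monoid B) x y = x \<oplus> y \<oplus> \<ominus> x \<oplus> \<ominus> y"
  by (simp add: group_commutator_def a_inv_def)

lemma lam_group_commutator:
  "\<lbrakk>x \<in> carrier B; y \<in> carrier B; z \<in> carrier B\<rbrakk> \<Longrightarrow>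
    lam x (group_commutator (add_monoid B) y z) = group_commutator (add_monoid B) (lam x y) (lam x z)"
  by (simp add: group_commutator_add lam_add lam_neg)

end

section \<open>Skew braces factorised by two abelian subbraces\<close>

text \<open>The hypotheses of the theorem in elementwise form. Only the additive factorisation
  appears, since the multiplicative one is reduced to it in the final proof.\<close>

locale brace_factorization = skew_brace B for B (structure) +
  fixes H K
  assumes subbrace_H: "subbrace B H" and subbrace_K: "subbrace B K"
    and H_trivial: "\<lbrakk>x \<in> H; y \<in> H\<rbrakk> \<Longrightarrow> x \<otimes> y = x \<oplus> y"
    and K_trivial: "\<lbrakk>x \<in> K; y \<in> K\<rbrakk> \<Longrightarrow> x \<otimes> y = x \<oplus> y"
    and H_comm: "\<lbrakk>x \<in> H; y \<in> H\<rbrakk> \<Longrightarrow> x \<oplus> y = y \<oplus> x"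
    and K_comm: "\<lbrakk>x \<in> K; y \<in> K\<rbrakk> \<Longrightarrow> x \<oplus> y = y \<oplus> x"
    and star_H: "\<lbrakk>x \<in> carrier B; h \<in> H\<rbrakk> \<Longrightarrow> x \<star> h \<in> H"
    and H_star: "\<lbrakk>h \<in> H; x \<in> carrier B\<rbrakk> \<Longrightarrow> h \<star> x \<in> H"
    and add_factorization: "carrier B = H <+> K"
begin

sublocale add: abelian_factorization "add_monoid B" H K
  rewrites "carrier (add_monoid B) = carrier B"
    and "monoid.mult (add_monoid B) = add B"
    and "one (add_monoid B) = \<zero>"
    and "m_inv (add_monoid B) = a_inv B"
proof -
  show "abelian_factorization (add_monoid B) H K"
    using subbrace_H subbrace_K H_comm K_comm add_factorization[unfolded set_add_def]
    by (intro abelian_factorization.intro add_group abelian_factorization_axioms.intro)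
      (simp_all only: subbrace_def partial_object.simps monoid.simps)
qed (simp_all add: a_inv_def)

sublocale H: subgroup H B
  using subbrace_H by (simp add: subbrace_def)

sublocale K: subgroup K B
  using subbrace_K by (simp add: subbrace_def)

abbreviation "com \<equiv> group_commutator (add_monoid B)"

lemma lam_H: "\<lbrakk>x \<in> carrier B; h \<in> H\<rbrakk> \<Longrightarrow> lam x h \<in> H"
  using star_H[of x h] by (simp add: lam_eq_star_add)

lemma lam_H_H: "\<lbrakk>h \<in> H; h' \<in> H\<rbrakk> \<Longrightarrow> lam h h' = h'"
  by (simp add: lam_def H_trivial)

lemma lam_K_K: "\<lbrakk>k \<in> K; k' \<in> K\<rbrakk> \<Longrightarrow> lam k k' = k'"
  by (simp add: lam_def K_trivial)

text \<open>\<open>k \<oplus> h\<close> equals \<open>k \<otimes> lam (inv k) h\<close>, and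
  \<open>H\<close> is invariant under \<open>lam\<close>.\<close>

lemma factor_mult_KH:
  assumes "x \<in> carrier B" obtains k h where "k \<in> K" "h \<in> H" "x = k \<otimes> h"
proof -
  obtain k h where "k \<in> K" "h \<in> H" "x = k \<oplus> h"
    using assms by (rule add.factor_KH)
  thus thesis
    by (intro that[of k "lam (inv k) h"]) (auto simp: lam_H add_eq_mult_lam)
qed

lemma factor_mult_HK:
  assumes "x \<in> carrier B" obtains h k where "h \<in> H" "k \<in> K" "x = h \<otimes> k"
proof -
  have "inv x \<in> carrier B" using assms by simp
  then obtain k h where kh: "k \<in> K" "h \<in> H" "inv x = k \<otimes> h"
    by (rule factor_mult_KH)
  have "x = inv (k \<otimes> h)"
    using assms by (simp flip: kh(3))
  with kh(1,2) show thesis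
    by (intro that[of "inv h" "inv k"]) (auto simp: inv_mult_group)
qed

section \<open>Brace products between the two factors\<close>

definition "star_HK = {h \<star> k | h k. h \<in> H \<and> k \<in> K}"
definition "star_KH = {k \<star> h | h k. h \<in> H \<and> k \<in> K}"

lemma star_HK_subset: "star_HK \<subseteq> H"
  by (auto simp: star_HK_def H_star)

lemma star_KH_subset: "star_KH \<subseteq> H"
  by (auto simp: star_KH_def star_H)

text \<open>For \<open>x = h' \<oplus> k\<close> the term \<open>h \<star> h'\<close> vanishes, and
  conjugation by \<open>h'\<close> fixes \<open>h \<star> k\<close> because both lie in the abelian
  \<open>H\<close>.\<close>

lemma H_star_in_star_HK:
  assumes "h \<in> H" "x \<in> carrier B"
  shows "h \<star> x \<in> star_HK"
proof -
  obtain h' k where x: "h' \<in> H" "k \<in> K" "x = h' \<oplus> k"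
    using assms(2) by (rule add.factor_HK)
  have "h \<star> x = h' \<oplus> h \<star> k \<oplus> \<ominus> h'"
    using assms x by (simp add: star_add_right star_closed) (simp add: star_eq lam_H_H)
  also have "h' \<oplus> h \<star> k = h \<star> k \<oplus> h'"
    using assms x by (intro H_comm H_star) auto
  finally have "h \<star> x = h \<star> k"
    using assms x by (simp add: star_closed add.m_assoc)
  with assms x show ?thesis by (auto simp: star_HK_def)
qed

lemma K_star_in_star_KH:
  assumes "k \<in> K" "x \<in> carrier B"
  shows "k \<star> x \<in> star_KH"
proof -
  obtain h k' where x: "h \<in> H" "k' \<in> K" "x = h \<oplus> k'"
    using assms(2) by (rule add.factor_HK)
  have "k \<star> x = k \<star> h"
    using assms x by (simp add: star_add_right star_closed) (simp add: star_eq lam_K_K)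
  with assms x show ?thesis by (auto simp: star_KH_def)
qed

lemma star_decomposition:
  assumes "x \<in> carrier B" "y \<in> carrier B"
  obtains s t where "s \<in> star_HK" "t \<in> star_KH" "x \<star> y = s \<oplus> t"
proof -
  obtain h k where x: "h \<in> H" "k \<in> K" "x = h \<otimes> k"
    using assms(1) by (rule factor_mult_HK)
  show thesis
    by (rule that[of "h \<star> lam k y" "k \<star> y"])
      (use assms x in \<open>auto simp: star_mult H_star_in_star_HK K_star_in_star_KH\<close>)
qed

section \<open>The lambda action on additive commutators\<close>

lemma lam_H_com:
  assumes "h1 \<in> H" "h \<in> H" "k \<in> K"
  shows "lam h1 (com h k) = h1 \<star> k \<oplus> com h k \<oplus> \<ominus> (h1 \<star> k)"
proof -
  have c: "h \<oplus> h1 \<star> k = h1 \<star> k \<oplus> h"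
    using assms by (intro H_comm H_star) auto
  have "lam h1 (com h k) = com h (h1 \<star> k \<oplus> k)"
    using assms by (simp add: lam_group_commutator lam_H_H lam_eq_star_add[of h1 k])
  also have "\<dots> = (h \<oplus> h1 \<star> k) \<oplus> k \<oplus> \<ominus> h \<oplus> \<ominus> k \<oplus> \<ominus> (h1 \<star> k)"
    using assms by (simp add: group_commutator_add add.m_assoc add.inv_mult_group star_closed)
  also have "\<dots> = h1 \<star> k \<oplus> com h k \<oplus> \<ominus> (h1 \<star> k)"
    unfolding c using assms by (simp add: group_commutator_add add.m_assoc star_closed)
  finally show ?thesis .
qed

lemma lam_K_com: "\<lbrakk>k1 \<in> K; h \<in> H; k \<in> K\<rbrakk> \<Longrightarrow> lam k1 (com h k) = com (lam k1 h) k"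
  by (simp add: lam_group_commutator lam_K_K)

lemma lam_commutators:
  assumes "g \<in> H \<union> K" "x \<in> add.commutators"
  shows "lam g x \<in> add.commutators"
proof -
  obtain h k where x: "h \<in> H" "k \<in> K" "x = com h k"
    using assms(2) by (auto simp: add.commutators_def)
  from assms(1) show ?thesis
  proof
    assume "g \<in> H"
    with x assms(2) show ?thesis
      using add.commutators_conj_H[of "g \<star> k" x] by (simp add: lam_H_com H_star)
  next
    assume "g \<in> K"
    with x have "lam g h \<in> H" "lam g x = com (lam g h) k"
      by (auto simp: lam_K_com lam_H)
    with x(2) show ?thesis
      by (auto simp: add.commutators_def)
  qed
qed

lemma lam_surj_commutators:
  assumes "g \<in> H \<union> K" "x \<in> add.commutators"
  obtains y where "y \<in> add.commutators" "x = lam g y"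
proof
  show "lam (inv g) x \<in> add.commutators"
    using assms by (intro lam_commutators) auto
  show "x = lam g (lam (inv g) x)"
    using assms add.commutators_carrier by auto
qed

text \<open>Conjugation by \<open>k1\<close> keeps the second entry \<open>k\<close>, so by
  \<open>lam_H_com\<close> the map \<open>lam h1\<close> acts on \<open>x\<close> and on its
  conjugate as conjugation by the same element \<open>h1 \<star> k\<close> of
  \<open>H\<close>.\<close>

lemma lam_H_conj_K:
  assumes "h1 \<in> H" "k1 \<in> K" "x \<in> add.commutators"
  shows "lam h1 (k1 \<oplus> x \<oplus> \<ominus> k1) = k1 \<oplus> lam h1 x \<oplus> \<ominus> k1"
proof -
  obtain h k where x: "h \<in> H" "k \<in> K" "x = com h k"
    using assms(3) by (auto simp: add.commutators_def)
  have "k1 \<oplus> h \<in> carrier B" using x assms by simp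
  then obtain h' k' where 1: "h' \<in> H" "k' \<in> K" "k1 \<oplus> h = h' \<oplus> k'" by (rule add.factor_HK)
  have conj: "k1 \<oplus> x \<oplus> \<ominus> k1 = com h' k"
    using x assms 1 add.conj_commutator_K[of h k k1 h' k'] by simp
  have "lam h1 (k1 \<oplus> x \<oplus> \<ominus> k1) = h1 \<star> k \<oplus> (k1 \<oplus> x \<oplus> \<ominus> k1) \<oplus> \<ominus> (h1 \<star> k)"
    using assms(1) 1(1) x(2) unfolding conj by (rule lam_H_com)
  also have "\<dots> = k1 \<oplus> (h1 \<star> k \<oplus> x \<oplus> \<ominus> (h1 \<star> k)) \<oplus> \<ominus> k1"
    using x assms by (intro add.conj_conj_commutators H_star) auto
  also have "h1 \<star> k \<oplus> x \<oplus> \<ominus> (h1 \<star> k) = lam h1 x"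
    using x assms by (simp add: lam_H_com)
  finally show ?thesis .
qed

text \<open>\<open>lam k1\<close> changes only the first entry and conjugation by \<open>h1\<close>
  only the second.\<close>

lemma lam_K_conj_H:
  assumes "h1 \<in> H" "k1 \<in> K" "x \<in> add.commutators"
  shows "lam k1 (h1 \<oplus> x \<oplus> \<ominus> h1) = h1 \<oplus> lam k1 x \<oplus> \<ominus> h1"
proof -
  obtain h k where x: "h \<in> H" "k \<in> K" "x = com h k"
    using assms(3) by (auto simp: add.commutators_def)
  have "h1 \<oplus> k \<in> carrier B" using x assms by simp
  then obtain h' k' where 1: "k' \<in> K" "h' \<in> H" "h1 \<oplus> k = k' \<oplus> h'" by (rule add.factor_KH)
  \<comment> \<open>Stated for every \<open>a\<close>, because it is applied both to
    \<open>h\<close> and to \<open>lam k1 h\<close> with the same \<open>k'\<close>.\<close>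
  have "h1 \<oplus> com a k \<oplus> \<ominus> h1 = com a k'" if "a \<in> H" for a
    using that x assms 1 add.conj_commutator_H[of a k h1 h' k'] by simp
  with x assms 1 show ?thesis
    by (simp add: lam_K_com lam_H)
qed

text \<open>Compute \<open>lam h (k \<oplus> z \<oplus> \<ominus> k)\<close> in two ways: the
  commuting rule gives the conjugate of \<open>y\<close> by \<open>k\<close>, which is
  \<open>x\<close>, while additivity gives the conjugate of \<open>y\<close> by
  \<open>lam h k = s \<oplus> k\<close>. Hence conjugation by \<open>s\<close> fixes
  \<open>x\<close>.\<close>

lemma star_HK_commute_commutators:
  assumes "s \<in> star_HK" "x \<in> add.commutators"
  shows "s \<oplus> x = x \<oplus> s"
proof -
  obtain h k where s: "h \<in> H" "k \<in> K" "s = h \<star> k"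
    using assms(1) by (auto simp: star_HK_def)
  obtain y where y: "y \<in> add.commutators" "x = k \<oplus> y \<oplus> \<ominus> k"
    by (rule add.conj_surj_commutators[of k x]) (use s assms in auto)
  obtain z where z: "z \<in> add.commutators" "y = lam h z"
    by (rule lam_surj_commutators[of h y]) (use s y in auto)
  have [simp]: "s \<in> carrier B" "y \<in> carrier B" "z \<in> carrier B"
    using s y z add.commutators_carrier by (auto simp: star_closed)
  have "x = lam h (k \<oplus> z \<oplus> \<ominus> k)"
    using s y z lam_H_conj_K by simp
  also have "\<dots> = lam h k \<oplus> y \<oplus> \<ominus> lam h k"
    using s by (simp add: lam_add lam_neg z)
  also have "lam h k = s \<oplus> k"
    using s by (simp add: lam_eq_star_add)
  also have "s \<oplus> k \<oplus> y \<oplus> \<ominus> (s \<oplus> k) = s \<oplus> x \<oplus> \<ominus> s"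
    using s(1,2) by (simp add: y(2) add.m_assoc add.inv_mult_group)
  finally show ?thesis
    using assms add.commutators_carrier by (intro add.commute_if_conj_fixed) auto
qed

lemma star_KH_commute_commutators:
  assumes "s \<in> star_KH" "x \<in> add.commutators"
  shows "s \<oplus> x = x \<oplus> s"
proof -
  obtain h k where s: "h \<in> H" "k \<in> K" "s = k \<star> h"
    using assms(1) by (auto simp: star_KH_def)
  obtain y where y: "y \<in> add.commutators" "x = h \<oplus> y \<oplus> \<ominus> h"
    by (rule add.conj_surj_commutators[of h x]) (use s assms in auto)
  obtain z where z: "z \<in> add.commutators" "y = lam k z"
    by (rule lam_surj_commutators[of k y]) (use s y in auto)
  have [simp]: "s \<in> carrier B" "y \<in> carrier B" "z \<in> carrier B"
    using s y z add.commutators_carrier by (auto simp: star_closed)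
  have "x = lam k (h \<oplus> z \<oplus> \<ominus> h)"
    using s y z lam_K_conj_H by simp
  also have "\<dots> = lam k h \<oplus> y \<oplus> \<ominus> lam k h"
    using s by (simp add: lam_add lam_neg z)
  also have "lam k h = s \<oplus> h"
    using s by (simp add: lam_eq_star_add)
  also have "s \<oplus> h \<oplus> y \<oplus> \<ominus> (s \<oplus> h) = s \<oplus> x \<oplus> \<ominus> s"
    using s(1,2) by (simp add: y(2) add.m_assoc add.inv_mult_group)
  finally show ?thesis
    using assms add.commutators_carrier by (intro add.commute_if_conj_fixed) auto
qed

section \<open>An additively abelian ideal containing the brace commutator\<close>

definition "com_ideal = generate (add_monoid B) (star_HK \<union> star_KH \<union> add.commutators)"

lemma com_ideal_generators_carrier: "star_HK \<union> star_KH \<union> add.commutators \<subseteq> carrier B"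
  using star_HK_subset star_KH_subset add.commutators_carrier H.subset by blast

sublocale com_ideal: subgroup com_ideal "add_monoid B"
  rewrites "carrier (add_monoid B) = carrier B"
    and "monoid.mult (add_monoid B) = add B"
    and "one (add_monoid B) = \<zero>"
    and "m_inv (add_monoid B) = a_inv B"
  unfolding com_ideal_def
  by (rule add.generate_is_subgroup[OF com_ideal_generators_carrier]) (simp_all add: a_inv_def)

lemma com_ideal_comm:
  assumes "x \<in> com_ideal" "y \<in> com_ideal"
  shows "x \<oplus> y = y \<oplus> x"
proof (rule add.generate_commute[OF com_ideal_generators_carrier])
  fix u v assume uv: "u \<in> star_HK \<union> star_KH \<union> add.commutators"
    "v \<in> star_HK \<union> star_KH \<union> add.commutators"
  have S_H: "star_HK \<union> star_KH \<subseteq> H"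
    using star_HK_subset star_KH_subset by blast
  have S_com: "s \<oplus> x = x \<oplus> s" if "s \<in> star_HK \<union> star_KH" "x \<in> add.commutators" for s x
    using that star_HK_commute_commutators star_KH_commute_commutators by blast
  from uv consider "u \<in> H" "v \<in> H" | "u \<in> star_HK \<union> star_KH" "v \<in> add.commutators"
    | "v \<in> star_HK \<union> star_KH" "u \<in> add.commutators" | "u \<in> add.commutators" "v \<in> add.commutators"
    using S_H by blast
  thus "u \<oplus> v = v \<oplus> u"
    by cases (fact H_comm S_com S_com[symmetric] add.commutators_commute)+
qed (use assms in \<open>simp_all add: com_ideal_def\<close>)

lemma star_in_com_ideal:
  assumes "x \<in> carrier B" "y \<in> carrier B"
  shows "x \<star> y \<in> com_ideal"
proof -
  obtain s t where "s \<in> star_HK" "t \<in> star_KH" "x \<star> y = s \<oplus> t"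
    using assms by (rule star_decomposition)
  moreover from this have "s \<in> com_ideal" "t \<in> com_ideal"
    by (auto simp: com_ideal_def intro: generate.incl)
  ultimately show ?thesis by simp
qed

lemma add_derived_subset_com_ideal: "derived (add_monoid B) (carrier B) \<subseteq> com_ideal"
proof -
  have "generate (add_monoid B) add.commutators \<subseteq> com_ideal"
    unfolding com_ideal_def by (rule add.mono_generate) blast
  thus ?thesis
    using add.derived_subset_generate_commutators by blast
qed

lemma com_in_com_ideal:
  assumes "x \<in> carrier B" "y \<in> carrier B"
  shows "com x y \<in> com_ideal"
proof -
  have "com x y \<in> derived (add_monoid B) (carrier B)"
    unfolding derived_def group_commutator_def using assms by (intro generate.incl) auto
  thus ?thesis
    using add_derived_subset_com_ideal by blast
qed

text \<open>Normality is automatic once all additive commutators are inside, as the conjugate of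
  \<open>i\<close> differs from \<open>i\<close> by \<open>com x i\<close>.\<close>

lemma com_ideal_conj:
  assumes "x \<in> carrier B" "i \<in> com_ideal"
  shows "x \<oplus> i \<oplus> \<ominus> x \<in> com_ideal"
proof -
  have "x \<oplus> i \<oplus> \<ominus> x = com x i \<oplus> i"
    using assms by (simp add: group_commutator_add add.m_assoc)
  thus ?thesis
    using assms by (simp add: com_in_com_ideal)
qed

lemma com_ideal_lam: "\<lbrakk>x \<in> carrier B; i \<in> com_ideal\<rbrakk> \<Longrightarrow> lam x i \<in> com_ideal"
  by (simp add: lam_eq_star_add star_in_com_ideal)

lemma inv_mult_in_com_ideal:
  assumes "x \<in> carrier B" "y \<in> carrier B" "y \<oplus> \<ominus> x \<in> com_ideal"
  shows "inv x \<otimes> y \<in> com_ideal"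
proof -
  have "\<ominus> x \<oplus> (y \<oplus> \<ominus> x) \<oplus> \<ominus> (\<ominus> x) \<in> com_ideal"
    using assms by (intro com_ideal_conj) auto
  hence "\<ominus> x \<oplus> y \<in> com_ideal"
    using assms by (simp add: add.m_assoc)
  thus ?thesis
    using assms by (simp add: inv_mult_eq_lam com_ideal_lam)
qed

lemma brace_ideal_com_ideal: "brace_ideal B com_ideal"
proof -
  have "subgroup com_ideal B"
  proof
    show "com_ideal \<subseteq> carrier B" by (rule com_ideal.subset)
    show "\<one> \<in> com_ideal" using com_ideal.one_closed by (simp add: one_eq_zero)
  next
    fix x y assume "x \<in> com_ideal" "y \<in> com_ideal"
    thus "x \<otimes> y \<in> com_ideal" by (simp add: mult_eq_add_lam com_ideal_lam)
  next
    fix x assume x: "x \<in> com_ideal"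
    \<comment> \<open>The two identities agree, so the additive difference to be checked is just
      \<open>\<ominus> x\<close>.\<close>
    hence "inv x \<otimes> \<one> \<in> com_ideal"
      by (intro inv_mult_in_com_ideal) (auto simp: one_eq_zero)
    with x show "inv x \<in> com_ideal" by simp
  qed
  moreover have "subgroup com_ideal (add_monoid B)"
    unfolding com_ideal_def by (rule add.generate_is_subgroup[OF com_ideal_generators_carrier])
  moreover have "star_span B S T \<subseteq> com_ideal" if "S \<subseteq> carrier B" "T \<subseteq> carrier B" for S T
    unfolding star_span_def
    using that star_in_com_ideal calculation(2) by (intro add.generate_subgroup_incl) blast+
  moreover have "com_ideal \<lhd> add_monoid B"
    using calculation(2) com_ideal_conj by (simp add: add.normal_inv_iff)
  ultimately show ?thesis
    using com_ideal.subset
    by (simp add: brace_ideal_def strong_left_ideal_def left_ideal_def right_ideal_def subbrace_def)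
qed

lemma mult_minus_add_in_com_ideal:
  assumes "x \<in> carrier B" "y \<in> carrier B"
  shows "x \<otimes> y \<oplus> \<ominus> (x \<oplus> y) \<in> com_ideal"
proof -
  have "x \<otimes> y \<oplus> \<ominus> (x \<oplus> y) = x \<oplus> x \<star> y \<oplus> \<ominus> x"
    using assms by (simp add: mult_eq_add_lam star_eq add.m_assoc add.inv_mult_group)
  thus ?thesis
    using assms by (simp add: com_ideal_conj star_in_com_ideal)
qed

text \<open>For the inverses \<open>u\<close>, \<open>v\<close> of \<open>x\<close>,
  \<open>y\<close> the commutator is \<open>inv (v \<otimes> u) \<otimes> (u \<otimes> v)\<close>.
  It suffices that \<open>u \<otimes> v\<close> and \<open>v \<otimes> u\<close> differ additively
  by an element of the ideal; both are compared with the sums, which differ by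
  \<open>com u v\<close>.\<close>

lemma mult_derived_subset_com_ideal: "derived B (carrier B) \<subseteq> com_ideal"
proof -
  have "x \<otimes> y \<otimes> inv x \<otimes> inv y \<in> com_ideal" if xy: "x \<in> carrier B" "y \<in> carrier B" for x y
  proof -
    define u v where uv: "u = inv x" "v = inv y"
    have [simp]: "u \<in> carrier B" "v \<in> carrier B" using xy by (simp_all add: uv)
    have "(u \<otimes> v \<oplus> \<ominus> (u \<oplus> v)) \<oplus> com u v \<oplus> \<ominus> (v \<otimes> u \<oplus> \<ominus> (v \<oplus> u)) \<in> com_ideal"
      by (intro com_ideal.m_closed com_ideal.m_inv_closed mult_minus_add_in_com_ideal
          com_in_com_ideal) auto
    also have "(u \<otimes> v \<oplus> \<ominus> (u \<oplus> v)) \<oplus> com u v \<oplus> \<ominus> (v \<otimes> u \<oplus> \<ominus> (v \<oplus> u)) =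
        u \<otimes> v \<oplus> \<ominus> (v \<otimes> u)"
      by (simp add: group_commutator_add add.m_assoc add.inv_mult_group)
    finally have "inv (v \<otimes> u) \<otimes> (u \<otimes> v) \<in> com_ideal"
      by (intro inv_mult_in_com_ideal) auto
    thus ?thesis
      using xy by (simp add: uv inv_mult_group m_assoc)
  qed
  moreover have "subgroup com_ideal B"
    using brace_ideal_com_ideal
    by (simp add: brace_ideal_def strong_left_ideal_def left_ideal_def subbrace_def)
  ultimately show ?thesis
    unfolding derived_def by (intro generate_subgroup_incl) auto
qed

lemma brace_commutator_subset: "brace_commutator B \<subseteq> com_ideal"
  unfolding brace_commutator_def generated_ideal_def
proof (intro Inter_lower CollectI conjI brace_ideal_com_ideal Un_least
    add_derived_subset_com_ideal mult_derived_subset_com_ideal)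
  show "{a \<otimes> b \<ominus> (a \<oplus> b) |a b. a \<in> carrier B \<and> b \<in> carrier B} \<subseteq> com_ideal"
    using mult_minus_add_in_com_ideal by (auto simp: a_minus_def)
qed

section \<open>Triviality of the ideal as a brace\<close>

definition "star_H_span = generate (add_monoid B) star_HK"

lemma star_HK_carrier: "star_HK \<subseteq> carrier B"
  using star_HK_subset H.subset by blast

sublocale star_H_span: subgroup star_H_span "add_monoid B"
  rewrites "carrier (add_monoid B) = carrier B"
    and "monoid.mult (add_monoid B) = add B"
    and "one (add_monoid B) = \<zero>"
    and "m_inv (add_monoid B) = a_inv B"
  unfolding star_H_span_def
  by (rule add.generate_is_subgroup[OF star_HK_carrier]) (simp_all add: a_inv_def)

lemma star_H_span_subset: "star_H_span \<subseteq> H"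
  unfolding star_H_span_def
  by (intro add.generate_subgroup_incl star_HK_subset add.subgroup_H)

lemma H_star_in_star_H_span: "\<lbrakk>h \<in> H; x \<in> carrier B\<rbrakk> \<Longrightarrow> h \<star> x \<in> star_H_span"
  by (simp add: star_H_span_def generate.incl H_star_in_star_HK)

lemma star_H_span_conj:
  assumes "x \<in> carrier B" "s \<in> star_H_span"
  shows "x \<oplus> s \<oplus> \<ominus> x \<in> star_H_span"
proof -
  have "x \<oplus> h \<star> k \<oplus> \<ominus> x \<in> star_H_span" if hk: "h \<in> H" "k \<in> K" for h k
  proof -
    \<comment> \<open>\<open>star_add_right\<close> solved for its conjugate term.\<close>
    have "x \<oplus> h \<star> k \<oplus> \<ominus> x = \<ominus> (h \<star> x) \<oplus> h \<star> (x \<oplus> k)"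
      using hk assms by (simp add: star_add_right star_closed)
    thus ?thesis
      using hk assms by (simp add: H_star_in_star_H_span)
  qed
  thus ?thesis
    using assms add.generate_hom_closed[OF add_conj_hom[OF assms(1)], of star_HK s] star_HK_carrier
    unfolding star_H_span_def by (auto simp: star_HK_def)
qed

text \<open>\<open>lam k1\<close> fixes \<open>k\<close>, so it only conjugates \<open>h\<close>
  multiplicatively. Of that conjugate \<open>h' \<otimes> k'\<close> only \<open>h'\<close> acts on
  \<open>k\<close>, and the resulting \<open>h' \<star> k\<close> lies in \<open>H\<close>, where
  \<open>lam h1\<close> is the identity.\<close>

lemma star_H_span_lam:
  assumes "x \<in> carrier B" "s \<in> star_H_span"
  shows "lam x s \<in> star_H_span"
proof -
  obtain h1 k1 where x: "h1 \<in> H" "k1 \<in> K" "x = h1 \<otimes> k1"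
    using assms(1) by (rule factor_mult_HK)
  have "lam x (h \<star> k) \<in> star_HK" if hk: "h \<in> H" "k \<in> K" for h k
  proof -
    have "k1 \<otimes> h \<otimes> inv k1 \<in> carrier B" using hk x by simp
    then obtain h' k' where 1: "h' \<in> H" "k' \<in> K" "k1 \<otimes> h \<otimes> inv k1 = h' \<otimes> k'"
      by (rule factor_mult_HK)
    have "lam k1 (h \<star> k) = (h' \<otimes> k') \<star> k"
      using hk x by (simp add: lam_star lam_K_K flip: 1(3))
    also have "\<dots> = h' \<star> k"
      using hk 1 by (simp add: star_eq lam_mult lam_K_K)
    finally have "lam x (h \<star> k) = h' \<star> k"
      using hk 1 x by (simp add: lam_mult star_closed lam_H_H H_star)
    with hk 1 show ?thesis
      by (auto simp: star_HK_def)
  qed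
  hence "lam x ` star_HK \<subseteq> star_H_span"
    by (auto simp: star_HK_def star_H_span_def intro: generate.incl)
  thus ?thesis
    using assms add.generate_hom_closed[OF lam_hom[OF assms(1)], of star_HK s] star_HK_carrier
    unfolding star_H_span_def by auto
qed

text \<open>Turns an additive translation by the span into a right multiplication by it, using
  invariance under conjugation and under \<open>lam\<close>.\<close>

lemma star_H_span_add_eq_mult:
  assumes "s \<in> star_H_span" "x \<in> carrier B"
  obtains t where "t \<in> star_H_span" "s \<oplus> x = x \<otimes> t"
proof
  have "\<ominus> x \<oplus> s \<oplus> \<ominus> (\<ominus> x) \<in> star_H_span"
    using assms by (intro star_H_span_conj) auto
  thus "lam (inv x) (\<ominus> x \<oplus> s \<oplus> x) \<in> star_H_span"
    using assms by (simp add: star_H_span_lam)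
  show "s \<oplus> x = x \<otimes> lam (inv x) (\<ominus> x \<oplus> s \<oplus> x)"
    using assms by (simp add: add.m_assoc flip: add_eq_mult_lam)
qed

text \<open>The elements that act trivially under \<open>lam\<close> both on the cosets of
  \<open>star_H_span\<close> and on \<open>com_ideal\<close>.\<close>

definition "lam_kernel =
  {x \<in> carrier B. (\<forall>y\<in>carrier B. x \<star> y \<in> star_H_span) \<and> (\<forall>i\<in>com_ideal. lam x i = i)}"

lemma lam_kernelI:
  assumes "x \<in> carrier B" "\<And>y. y \<in> carrier B \<Longrightarrow> x \<star> y \<in> star_H_span"
    "\<And>i. i \<in> com_ideal \<Longrightarrow> lam x i = i"
  shows "x \<in> lam_kernel"
  using assms by (simp add: lam_kernel_def)

lemma lam_kernelD:
  assumes "x \<in> lam_kernel"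
  shows "x \<in> carrier B" "y \<in> carrier B \<Longrightarrow> x \<star> y \<in> star_H_span"
    "i \<in> com_ideal \<Longrightarrow> lam x i = i"
  using assms by (simp_all add: lam_kernel_def)

text \<open>On commutators \<open>lam h\<close> is conjugation by an element of
  \<open>star_HK\<close>, which commutes with them; the remaining generators lie in
  \<open>H\<close>. Additivity extends this to the span.\<close>

lemma H_lam_kernel:
  assumes "h \<in> H"
  shows "h \<in> lam_kernel"
proof (rule lam_kernelI)
  have gen: "lam h x = x" if "x \<in> star_HK \<union> star_KH \<union> add.commutators" for x
    using that
  proof (elim UnE)
    assume "x \<in> add.commutators"
    moreover then obtain a k where x: "a \<in> H" "k \<in> K" "x = com a k"
      by (auto simp: add.commutators_def)
    ultimately have "h \<star> k \<oplus> x = x \<oplus> h \<star> k"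
      using assms by (intro star_HK_commute_commutators H_star_in_star_HK) auto
    with x assms show ?thesis
      by (simp add: lam_H_com add.m_assoc star_closed)
  qed (use assms lam_H_H star_HK_subset star_KH_subset in blast)+
  fix i assume "i \<in> com_ideal"
  thus "lam h i = i"
    unfolding com_ideal_def
  proof induction
    case (inv x)
    moreover from inv have "x \<in> carrier B" using com_ideal_generators_carrier by blast
    ultimately show ?case using gen[of x] assms by (simp add: lam_neg flip: a_inv_def)
  next
    case (eng x y)
    moreover from eng have "x \<in> carrier B" "y \<in> carrier B"
      using add.generate_in_carrier[OF com_ideal_generators_carrier] by auto
    ultimately show ?case using assms by (simp add: lam_add)
  qed (use gen assms in auto)
qed (use assms H_star_in_star_H_span in auto)

lemma lam_kernel_mult:
  assumes "x \<in> lam_kernel" "y \<in> lam_kernel"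
  shows "x \<otimes> y \<in> lam_kernel"
  using assms lam_kernelD[OF assms(1)] lam_kernelD[OF assms(2)]
  by (intro lam_kernelI) (auto simp: star_mult lam_mult)

lemma lam_kernel_inv:
  assumes "x \<in> lam_kernel"
  shows "inv x \<in> lam_kernel"
proof (rule lam_kernelI)
  note x = lam_kernelD[OF assms]
  show "inv x \<in> carrier B" using x by simp
  fix y assume y: "y \<in> carrier B"
  have "inv x \<star> y = \<ominus> (x \<star> lam (inv x) y)"
    using x(1) y by (simp add: star_eq add.inv_mult_group)
  thus "inv x \<star> y \<in> star_H_span"
    using x y by simp
next
  note x = lam_kernelD[OF assms]
  fix i assume i: "i \<in> com_ideal"
  have "lam (inv x) (lam x i) = i"
    using x(1) i by simp
  thus "lam (inv x) i = i" using x(3) i by simp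
qed

lemma lam_kernel_conj:
  assumes "x \<in> lam_kernel" "y \<in> carrier B"
  shows "y \<otimes> x \<otimes> inv y \<in> lam_kernel"
proof (rule lam_kernelI)
  note x = lam_kernelD[OF assms(1)]
  show "y \<otimes> x \<otimes> inv y \<in> carrier B" using x assms by simp
  fix z assume z: "z \<in> carrier B"
  have "(y \<otimes> x \<otimes> inv y) \<star> z = lam y (x \<star> lam (inv y) z)"
    using x(1) z assms by (simp add: lam_star)
  thus "(y \<otimes> x \<otimes> inv y) \<star> z \<in> star_H_span"
    using x z assms by (simp add: star_H_span_lam)
next
  note x = lam_kernelD[OF assms(1)]
  fix i assume "i \<in> com_ideal"
  thus "lam (y \<otimes> x \<otimes> inv y) i = i"
    using x assms by (simp add: lam_mult com_ideal_lam)
qed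

text \<open>Put \<open>m = inv x \<otimes> y\<close>. Then \<open>x \<oplus> \<ominus> y\<close>
  equals \<open>x \<otimes> lam m (inv y)\<close>, and \<open>lam m (inv y)\<close> is
  \<open>inv y \<otimes> t\<close> with \<open>t\<close> in the span. As
  \<open>x = y \<otimes> inv m\<close>, the result is a conjugate of \<open>inv m\<close> times
  \<open>t\<close>, and \<open>t\<close> lies in \<open>H\<close>.\<close>

lemma lam_kernel_minus:
  assumes "x \<in> carrier B" "y \<in> carrier B" "inv x \<otimes> y \<in> lam_kernel"
  shows "x \<oplus> \<ominus> y \<in> lam_kernel"
proof -
  have "(inv x \<otimes> y) \<star> inv y \<in> star_H_span"
    using assms lam_kernelD by simp
  then obtain t where t: "t \<in> star_H_span" "(inv x \<otimes> y) \<star> inv y \<oplus> inv y = inv y \<otimes> t"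
    using inv_closed[OF assms(2)] by (rule star_H_span_add_eq_mult)
  have "x \<oplus> \<ominus> y = x \<otimes> lam (inv x \<otimes> y) (inv y)"
    using assms by (simp add: add_eq_mult_lam[of x] lam_mult neg_eq_lam_inv)
  also have "\<dots> = x \<otimes> (inv y \<otimes> t)"
    using assms t by (simp add: lam_eq_star_add)
  also have "\<dots> = y \<otimes> inv (inv x \<otimes> y) \<otimes> inv y \<otimes> t"
    using assms t by (simp add: inv_mult_group m_assoc)
  also have "\<dots> \<in> lam_kernel"
    using t(1) star_H_span_subset
    by (intro lam_kernel_mult[OF lam_kernel_conj[OF lam_kernel_inv[OF assms(3)] assms(2)]]
        H_lam_kernel) auto
  finally show ?thesis .
qed

text \<open>The commutator is the difference of \<open>h \<oplus> k\<close> and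
  \<open>k \<oplus> h\<close>. These equal \<open>h \<otimes> k \<otimes> t\<close> and
  \<open>k \<otimes> h'\<close> with \<open>t\<close>, \<open>h'\<close> in \<open>H\<close>, so
  modulo the normal subgroup \<open>lam_kernel\<close> both are congruent to
  \<open>k\<close>.\<close>

lemma lam_kernel_com:
  assumes "h \<in> H" "k \<in> K"
  shows "com h k \<in> lam_kernel"
proof -
  define h' where "h' = lam (inv k) h"
  have h': "h' \<in> H" "k \<oplus> h = k \<otimes> h'"
    using assms by (auto simp: h'_def lam_H add_eq_mult_lam)
  have "inv h \<star> k \<in> star_H_span"
    using assms by (simp add: H_star_in_star_H_span)
  then obtain t where t: "t \<in> star_H_span" "inv h \<star> k \<oplus> k = k \<otimes> t"
    using K.mem_carrier[OF assms(2)] by (rule star_H_span_add_eq_mult)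
  have hk: "h \<oplus> k = h \<otimes> (k \<otimes> t)"
    using assms t by (simp add: add_eq_mult_lam[of h] lam_eq_star_add)
  have tH: "t \<in> H" using t star_H_span_subset by auto
  have "inv t \<otimes> (inv k \<otimes> inv h \<otimes> inv (inv k)) \<otimes> h' \<in> lam_kernel"
    using assms
    by (intro lam_kernel_mult[OF lam_kernel_mult[OF lam_kernel_inv]] lam_kernel_conj[OF lam_kernel_inv]
        H_lam_kernel tH h'(1)) auto
  also have "inv t \<otimes> (inv k \<otimes> inv h \<otimes> inv (inv k)) \<otimes> h' = inv (h \<oplus> k) \<otimes> (k \<oplus> h)"
    unfolding hk h'(2) using assms h' tH by (simp add: inv_mult_group m_assoc)
  finally have "h \<oplus> k \<oplus> \<ominus> (k \<oplus> h) \<in> lam_kernel"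
    using assms by (intro lam_kernel_minus) auto
  thus ?thesis
    using assms by (simp add: group_commutator_add add.inv_mult_group add.m_assoc)
qed

lemma com_ideal_subset_lam_kernel: "com_ideal \<subseteq> lam_kernel"
proof -
  \<comment> \<open>Closure under subtraction makes the multiplicative subgroup an additive one, so
    only generators of \<open>com_ideal\<close> remain to be checked.\<close>
  have minus: "x \<oplus> \<ominus> y \<in> lam_kernel" if "x \<in> lam_kernel" "y \<in> lam_kernel" for x y
    using that lam_kernelD by (intro lam_kernel_minus lam_kernel_mult lam_kernel_inv) auto
  have zero: "\<zero> \<in> lam_kernel"
    using H_lam_kernel[OF H.one_closed] by (simp add: one_eq_zero)
  have neg: "\<ominus> x \<in> lam_kernel" if "x \<in> lam_kernel" for x
    using minus[OF zero that] lam_kernelD(1)[OF that] by simp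
  have "x \<oplus> y \<in> lam_kernel" if "x \<in> lam_kernel" "y \<in> lam_kernel" for x y
    using minus[OF that(1) neg[OF that(2)]] lam_kernelD(1)[OF that(2)] by simp
  with zero neg have "subgroup lam_kernel (add_monoid B)"
    by (intro add.subgroupI) (auto intro: lam_kernelD(1))
  moreover have "star_HK \<union> star_KH \<union> add.commutators \<subseteq> lam_kernel"
    using star_HK_subset star_KH_subset H_lam_kernel lam_kernel_com
    by (auto simp: add.commutators_def)
  ultimately show ?thesis
    unfolding com_ideal_def by (intro add.generate_subgroup_incl)
qed

lemma com_ideal_star_eq_zero:
  assumes "x \<in> com_ideal" "y \<in> com_ideal"
  shows "x \<star> y = \<zero>"
proof -
  have "lam x y = y"
    using assms com_ideal_subset_lam_kernel lam_kernelD(3) by blast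
  with assms show ?thesis
    by (simp add: star_eq)
qed

lemma abelian_brace_commutator: "abelian_skew_brace (B\<lparr>carrier := brace_commutator B\<rparr>)"
proof -
  let ?C = "brace_commutator B"
  have "brace_ideal B ?C"
    unfolding brace_commutator_def
    using add.derived_in_carrier[OF subset_refl] derived_in_carrier[OF subset_refl]
    by (intro brace_ideal_generated_ideal) (auto simp: a_minus_def)
  hence sub: "subbrace B ?C"
    by (simp add: brace_ideal_def right_ideal_def)
  hence add_sub: "subgroup ?C (add_monoid B)"
    by (simp add: subbrace_def)
  show ?thesis
  proof (intro abelian_skew_brace.intro trivial_skew_brace.intro subbrace_is_skew_brace sub
      trivial_skew_brace_axioms.intro abelian_skew_brace_axioms.intro)
    fix x y assume "x \<in> carrier (B\<lparr>carrier := ?C\<rparr>)" "y \<in> carrier (B\<lparr>carrier := ?C\<rparr>)"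
    hence xy: "x \<in> ?C" "y \<in> ?C" by simp_all
    hence xy': "x \<in> com_ideal" "y \<in> com_ideal"
      using brace_commutator_subset by auto
    show "x \<star>\<^bsub>B\<lparr>carrier := ?C\<rparr>\<^esub> y = \<zero>\<^bsub>B\<lparr>carrier := ?C\<rparr>\<^esub>"
      unfolding star_restrict[OF add_sub xy] com_ideal_star_eq_zero[OF xy'] by simp
    have "x \<oplus> y = y \<oplus> x"
      using xy' by (rule com_ideal_comm)
    thus "x \<oplus>\<^bsub>B\<lparr>carrier := ?C\<rparr>\<^esub> y = y \<oplus>\<^bsub>B\<lparr>carrier := ?C\<rparr>\<^esub> x"
      by simp
  qed
qed

end

lemma (in skew_brace) abelian_subbraceD:
  assumes "subbrace B L" "abelian_skew_brace (B\<lparr>carrier := L\<rparr>)" "x \<in> L" "y \<in> L"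
  shows "x \<otimes> y = x \<oplus> y" "x \<oplus> y = y \<oplus> x"
proof -
  have L: "subgroup L (add_monoid B)"
    using assms(1) by (simp add: subbrace_def)
  have "x \<star> y = \<zero>"
    using trivial_skew_brace.star_zero[OF abelian_skew_brace.axioms(1)[OF assms(2)], of x y] assms(3,4)
    by (simp add: star_restrict[OF L])
  moreover have [simp]: "x \<in> carrier B" "y \<in> carrier B"
    using assms(3,4) subgroup.subset[OF L] by auto
  ultimately have "lam x y = y"
    by (simp add: lam_eq_star_add star_closed)
  thus "x \<otimes> y = x \<oplus> y"
    by (simp add: mult_eq_add_lam)
  show "x \<oplus> y = y \<oplus> x"
    using abelian_skew_brace.add_comm[OF assms(2)] assms(3,4) by simp
qed

theorem theorem1:
  fixes B :: "('a, 'm) ring_scheme"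
    and A\<^sub>1 A\<^sub>2 :: "'a set"
  assumes "skew_brace B"
    and "subbrace B A\<^sub>1" and "subbrace B A\<^sub>2"
    and "abelian_skew_brace (B\<lparr>carrier := A\<^sub>1\<rparr>)"
    and "abelian_skew_brace (B\<lparr>carrier := A\<^sub>2\<rparr>)"
    and "carrier B = A\<^sub>1 <+>\<^bsub>B\<^esub> A\<^sub>2 \<or> carrier B = A\<^sub>1 <#>\<^bsub>B\<^esub> A\<^sub>2"
    and "left_ideal B A\<^sub>1" and "right_ideal B A\<^sub>1"
  shows "abelian_skew_brace (B\<lparr>carrier := brace_commutator B\<rparr>)"
proof -
  interpret skew_brace B by fact
  have sub: "subgroup A\<^sub>1 B" "subgroup A\<^sub>2 B"
    and add_sub: "subgroup A\<^sub>1 (add_monoid B)" "subgroup A\<^sub>2 (add_monoid B)"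
    using assms(2,3) by (simp_all add: subbrace_def)
  have star_A1: "x \<star>\<^bsub>B\<^esub> a \<in> A\<^sub>1" if "x \<in> carrier B" "a \<in> A\<^sub>1" for x a
    using that assms(7) unfolding left_ideal_def star_span_def by (blast intro: generate.incl)
  have A1_star: "a \<star>\<^bsub>B\<^esub> x \<in> A\<^sub>1" if "x \<in> carrier B" "a \<in> A\<^sub>1" for x a
    using that assms(8) unfolding right_ideal_def star_span_def by (blast intro: generate.incl)
  have "carrier B = A\<^sub>1 <+>\<^bsub>B\<^esub> A\<^sub>2" if mult: "carrier B = A\<^sub>1 <#>\<^bsub>B\<^esub> A\<^sub>2"
  proof -
    \<comment> \<open>The order is swapped so that in
      \<open>k \<otimes> h = k \<oplus> lam k h\<close> the action falls on the left ideal and stays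
      inside it.\<close>
    have KH: "carrier B = A\<^sub>2 <#>\<^bsub>B\<^esub> A\<^sub>1"
      by (rule set_mult_subgroups_commute[OF sub mult])
    have "\<exists>k\<in>A\<^sub>2. \<exists>h\<in>A\<^sub>1. x = k \<oplus>\<^bsub>B\<^esub> h" if x: "x \<in> carrier B" for x
    proof -
      obtain k h where kh: "k \<in> A\<^sub>2" "h \<in> A\<^sub>1" "x = k \<otimes>\<^bsub>B\<^esub> h"
        using x[unfolded KH] by (auto simp: set_mult_def)
      have carr: "k \<in> carrier B" "h \<in> carrier B"
        using kh sub subgroup.subset by blast+
      have "lam k h \<in> A\<^sub>1"
        using subgroup.m_closed[OF add_sub(1) star_A1[OF carr(1) kh(2)] kh(2)] carr
        by (simp add: lam_eq_star_add)
      with kh carr show ?thesis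
        using mult_eq_add_lam by blast
    qed
    moreover have "A\<^sub>1 \<subseteq> carrier B" "A\<^sub>2 \<subseteq> carrier B"
      using sub subgroup.subset by blast+
    ultimately have "carrier B = A\<^sub>2 <#>\<^bsub>add_monoid B\<^esub> A\<^sub>1"
      by (auto simp: set_mult_def)
    thus ?thesis
      using add.set_mult_subgroups_commute[OF add_sub(2,1)] by (simp add: set_add_def)
  qed
  hence factorization: "carrier B = A\<^sub>1 <+>\<^bsub>B\<^esub> A\<^sub>2"
    using assms(6) by blast
  interpret brace_factorization B A\<^sub>1 A\<^sub>2
    by (intro brace_factorization.intro brace_factorization_axioms.intro assms(1-3) factorization
        star_A1 A1_star abelian_subbraceD[OF assms(2,4)] abelian_subbraceD[OF assms(3,5)])
  show ?thesis
    by (rule abelian_brace_commutator)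
qed

end
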